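(* Let $n$ be an arbitrary positive integer and $\lambda$ an arbitrary infinite cardinal. Then every shift-continuous semiregular feebly compact $T_1$-topology $\tau$ on $\mathscr{I}_\lambda^n$ is compact.
   Context: For a cardinal $\lambda$, $\mathscr{I}_\lambda$ is the semigroup of all partial one-to-one transformations of $\lambda$ (injective maps $\alpha$ from a subset $\operatorname{dom}\alpha\subseteq\lambda$ into $\lambda$) with composition of partial maps $x(\alpha\beta)=(x\alpha)\beta$ for $x\in\operatorname{dom}(\alpha\beta)=\{y\in\operatorname{dom}\alpha : y\alpha\in\operatorname{dom}\beta\}$; the rank of $\alpha$ is $|\operatorname{ran}\alpha|$. $\mathscr{I}_\lambda^n=\{\alpha\in\mathscr{I}_\lambda : \operatorname{rank}\alpha\leqslant n\}$ (it contains the empty map). A topology $\tau$ on a semigroup $S$ is shift-continuous if the multiplication of $S$ is separately continuous with respect to $\tau$ (all left and right translations are continuous). A subset $A$ of a space $X$ is regular open if $\operatorname{int}_X(\operatorname{cl}_X(A))=A$. A space is semiregular if it has a base consisting of regular open subsets. A space $X$ is feebly compact if each locally finite open cover of $X$ is finite. Compact means that each open cover has a finite subcover. *)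

theory Defs
  imports "HOL-Analysis.Analysis"
begin

definition sym_inv :: "'a set \<Rightarrow> ('a \<rightharpoonup> 'a) set"
  where "sym_inv L = {\<alpha>. dom \<alpha> \<subseteq> L \<and> ran \<alpha> \<subseteq> L \<and> inj_on \<alpha> (dom \<alpha>)}"

text \<open>The finiteness conjunct is needed because \<^const>\<open>card\<close> is 0 on infinite sets.\<close>

definition sym_inv_rank :: "nat \<Rightarrow> 'a set \<Rightarrow> ('a \<rightharpoonup> 'a) set"
  where "sym_inv_rank n L = {\<alpha> \<in> sym_inv L. finite (ran \<alpha>) \<and> card (ran \<alpha>) \<le> n}"

text \<open>Maps act on the right: \<open>x(\<alpha>\<beta>) = (x\<alpha>)\<beta>\<close>.\<close>

definition pmult :: "('a \<rightharpoonup> 'a) \<Rightarrow> ('a \<rightharpoonup> 'a) \<Rightarrow> ('a \<rightharpoonup> 'a)"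
  where "pmult \<alpha> \<beta> = \<beta> \<circ>\<^sub>m \<alpha>"

lemma dom_pmult: "dom (pmult \<alpha> \<beta>) = {y \<in> dom \<alpha>. the (\<alpha> y) \<in> dom \<beta>}"
  by (auto simp: pmult_def map_comp_def dom_def split: option.splits)

lemma pmult_assoc: "pmult (pmult \<alpha> \<beta>) \<gamma> = pmult \<alpha> (pmult \<beta> \<gamma>)"
  by (auto simp: pmult_def map_comp_def fun_eq_iff split: option.splits)

lemma pmult_in_sym_inv_rank:
  assumes "\<alpha> \<in> sym_inv_rank n L" "\<beta> \<in> sym_inv_rank n L"
  shows "pmult \<alpha> \<beta> \<in> sym_inv_rank n L"
proof -
  have r: "ran (pmult \<alpha> \<beta>) \<subseteq> ran \<beta>" and d: "dom (pmult \<alpha> \<beta>) \<subseteq> dom \<alpha>"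
    by (auto simp: pmult_def ran_def map_comp_Some_iff)
  have "inj_on (pmult \<alpha> \<beta>) (dom (pmult \<alpha> \<beta>))"
  proof (rule inj_onI)
    fix x y
    assume "x \<in> dom (pmult \<alpha> \<beta>)" "y \<in> dom (pmult \<alpha> \<beta>)" "pmult \<alpha> \<beta> x = pmult \<alpha> \<beta> y"
    then obtain u v w where "\<alpha> x = Some u" "\<alpha> y = Some v" "\<beta> u = Some w" "\<beta> v = Some w"
      by (auto simp: pmult_def map_comp_Some_iff)
    moreover from this have "u = v"
      using assms(2) by (auto simp: sym_inv_rank_def sym_inv_def dest: inj_onD[where x=u and y=v])
    ultimately show "x = y"
      using assms(1) by (auto simp: sym_inv_rank_def sym_inv_def dest: inj_onD[where x=x and y=y])
  qed
  then show ?thesis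
    using assms r d card_mono[of "ran \<beta>" "ran (pmult \<alpha> \<beta>)"] finite_subset[OF r]
    by (auto simp: sym_inv_rank_def sym_inv_def)
qed

definition shift_continuous :: "('s \<Rightarrow> 's \<Rightarrow> 's) \<Rightarrow> 's topology \<Rightarrow> bool"
  where "shift_continuous f X \<longleftrightarrow>
    (\<forall>a \<in> topspace X. continuous_map X X (\<lambda>x. f a x) \<and> continuous_map X X (\<lambda>x. f x a))"

definition regular_open_in :: "'s topology \<Rightarrow> 's set \<Rightarrow> bool"
  where "regular_open_in X A \<longleftrightarrow> X interior_of (X closure_of A) = A"

definition semiregular_space :: "'s topology \<Rightarrow> bool"
  where "semiregular_space X \<longleftrightarrow>
    (\<exists>\<B>. (\<forall>B \<in> \<B>. regular_open_in X B) \<and> openin X = arbitrary union_of (\<lambda>B. B \<in> \<B>))"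

definition feebly_compact_space :: "'s topology \<Rightarrow> bool"
  where "feebly_compact_space X \<longleftrightarrow>
    (\<forall>\<U>. (\<forall>U \<in> \<U>. openin X U) \<and> \<Union>\<U> = topspace X \<and> locally_finite_in X \<U> \<longrightarrow> finite \<U>)"

end

theory Submission
  imports Defs
begin

text \<open>
  For \<open>\<alpha>\<close> in the semigroup the set of extensions of \<open>\<alpha>\<close> is clopen, because the two-sided shift by
  the partial identities of \<open>dom \<alpha>\<close> and \<open>ran \<alpha>\<close> has finite range; in particular maps of rank \<open>n\<close>
  are isolated. If a neighbourhood \<open>U\<close> of \<open>\<alpha>\<close> misses infinitely many rank \<open>n\<close> extensions of \<open>\<alpha>\<close>
  that pairwise agree only on \<open>\<alpha>\<close>, then these isolated points form a locally finite family, against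
  feeble compactness. So the rank \<open>n\<close> extensions of \<open>\<alpha>\<close> outside \<open>U\<close> all extend one of finitely
  many proper extensions \<open>\<delta>\<close> of \<open>\<alpha>\<close>. It follows that the maps of rank \<open>n\<close> are dense, and then, if
  \<open>U\<close> is regular open, that all extensions of \<open>\<alpha>\<close> outside \<open>U\<close> extend one of these \<open>\<delta>\<close>. Compactness
  of the set of extensions of \<open>\<alpha>\<close> follows by downward induction on the rank of \<open>\<alpha>\<close>.
\<close>

section \<open>Finite partial injections and their restrictions\<close>

lemma sym_inv_rank_dom:
  assumes "\<alpha> \<in> sym_inv_rank n L"
  shows "finite (dom \<alpha>)" "card (dom \<alpha>) \<le> n" "card (ran \<alpha>) = card (dom \<alpha>)"
proof -
  have r: "ran \<alpha> = (the \<circ> \<alpha>) ` dom \<alpha>"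
    by (force simp: ran_def dom_def)
  have "inj_on (the \<circ> \<alpha>) (dom \<alpha>)"
    using assms by (auto simp: sym_inv_rank_def sym_inv_def inj_on_def dom_def)
  then have "bij_betw (the \<circ> \<alpha>) (dom \<alpha>) (ran \<alpha>)"
    by (simp add: bij_betw_def r)
  then show "finite (dom \<alpha>)" "card (dom \<alpha>) \<le> n" "card (ran \<alpha>) = card (dom \<alpha>)"
    using assms by (auto simp: sym_inv_rank_def bij_betw_finite bij_betw_same_card)
qed

lemma sym_inv_rank_map_le:
  assumes "\<beta> \<in> sym_inv_rank n L" "\<alpha> \<subseteq>\<^sub>m \<beta>"
  shows "\<alpha> \<in> sym_inv_rank n L"
proof -
  have d: "dom \<alpha> \<subseteq> dom \<beta>"
    using assms(2) by (rule map_le_implies_dom_le)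
  have r: "ran \<alpha> \<subseteq> ran \<beta>"
    using assms(2) by (force simp: map_le_def ran_def dom_def)
  have "inj_on \<beta> (dom \<alpha>)"
    using assms(1) d by (auto simp: sym_inv_rank_def sym_inv_def intro: inj_on_subset)
  then have "inj_on \<alpha> (dom \<alpha>)"
    using assms(2) by (simp add: map_le_def inj_on_def)
  moreover have "card (ran \<alpha>) \<le> card (ran \<beta>)" "finite (ran \<alpha>)"
    using assms(1) r by (auto simp: sym_inv_rank_def intro: card_mono finite_subset)
  ultimately show ?thesis
    using assms(1) d r by (auto simp: sym_inv_rank_def sym_inv_def)
qed

lemma finite_maps_dom_ran:
  assumes "finite A" "finite B"
  shows "finite {m. dom m \<subseteq> A \<and> ran m \<subseteq> B}"
proof -
  have "{m. dom m \<subseteq> A \<and> ran m \<subseteq> B} = (\<Union>D\<in>Pow A. {m. dom m = D \<and> ran m \<subseteq> B})"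
    by auto
  with assms show ?thesis
    by (auto intro!: finite_set_of_finite_maps intro: finite_subset)
qed

lemma map_le_dom_eq:
  assumes "\<alpha> \<subseteq>\<^sub>m \<beta>" "dom \<beta> \<subseteq> dom \<alpha>"
  shows "\<alpha> = \<beta>"
proof
  fix x
  show "\<alpha> x = \<beta> x"
  proof (cases "x \<in> dom \<alpha>")
    case False
    then have "x \<notin> dom \<beta>"
      using assms(2) by blast
    with False show ?thesis
      by (simp add: domIff)
  qed (use assms(1) in \<open>simp add: map_le_def\<close>)
qed

lemma finite_map_le:
  assumes "finite (dom \<beta>)"
  shows "finite {\<delta>. \<delta> \<subseteq>\<^sub>m \<beta>}"
proof -
  have "{\<delta>. \<delta> \<subseteq>\<^sub>m \<beta>} \<subseteq> {m. dom m \<subseteq> dom \<beta> \<and> ran m \<subseteq> ran \<beta>}"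
    by (auto dest: map_le_implies_dom_le) (force simp: map_le_def ran_def dom_def)
  moreover have "finite (ran \<beta>)"
    using assms by (rule finite_ran)
  ultimately show ?thesis
    by (rule finite_subset[OF _ finite_maps_dom_ran[OF assms]])
qed

section \<open>Partial identities and extension to rank \<open>n\<close>\<close>

definition partial_id :: "'a set \<Rightarrow> ('a \<rightharpoonup> 'a)"
  where "partial_id A = (\<lambda>x. if x \<in> A then Some x else None)"

lemma partial_id_in_sym_inv_rank:
  assumes "A \<subseteq> L" "finite A" "card A \<le> n"
  shows "partial_id A \<in> sym_inv_rank n L"
proof -
  have "dom (partial_id A) = A" "ran (partial_id A) = A"
    by (auto simp: partial_id_def dom_def ran_def)
  moreover have "inj_on (partial_id A) A"
    by (auto simp: partial_id_def inj_on_def)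
  ultimately show ?thesis
    using assms by (simp add: sym_inv_rank_def sym_inv_def)
qed

text \<open>The product keeps exactly the pairs of \<open>\<beta>\<close> lying in
  \<open>dom \<alpha> \<times> ran \<alpha>\<close>. This turns extending \<open>\<alpha>\<close>
  into a condition on the value of a composite of two shifts.\<close>

lemma pmult_partial_id_eq_iff:
  assumes "inj_on \<beta> (dom \<beta>)"
  shows "pmult (pmult (partial_id (dom \<alpha>)) \<beta>) (partial_id (ran \<alpha>)) = \<alpha> \<longleftrightarrow> \<alpha> \<subseteq>\<^sub>m \<beta>"
    (is "?\<gamma> = \<alpha> \<longleftrightarrow> _")
proof -
  have \<gamma>: "?\<gamma> x = Some y \<longleftrightarrow> x \<in> dom \<alpha> \<and> \<beta> x = Some y \<and> y \<in> ran \<alpha>" for x y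
    by (auto simp: pmult_def partial_id_def map_comp_Some_iff split: if_splits)
  show ?thesis
  proof
    assume "?\<gamma> = \<alpha>"
    then show "\<alpha> \<subseteq>\<^sub>m \<beta>"
      using \<gamma> by (metis domD map_le_def)
  next
    assume le: "\<alpha> \<subseteq>\<^sub>m \<beta>"
    have "?\<gamma> x = Some y \<longleftrightarrow> \<alpha> x = Some y" for x y
      using le unfolding \<gamma> by (metis domI map_le_def ranI)
    then show "?\<gamma> = \<alpha>"
      by (metis not_None_eq ext)
  qed
qed

text \<open>Pairs are added one at a time; as \<open>L\<close> is infinite, a new argument outside
  \<open>dom \<alpha> \<union> Z\<close> and a new value outside \<open>ran \<alpha>\<close> always
  exist. The set \<open>Z\<close> serves to avoid the domains of finitely many given maps.\<close>

lemma sym_inv_rank_extend: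
  assumes "\<alpha> \<in> sym_inv_rank n L" "infinite L" "finite Z"
  shows "\<exists>\<beta> \<in> sym_inv_rank n L. \<alpha> \<subseteq>\<^sub>m \<beta> \<and> card (dom \<beta>) = n \<and> dom \<beta> \<inter> Z \<subseteq> dom \<alpha>"
  using assms(1)
proof (induction "n - card (dom \<alpha>)" arbitrary: \<alpha>)
  \<comment> \<open>Truncated subtraction yields only \<open>n \<le> card (dom \<alpha>)\<close>;
    the rank bound gives equality.\<close>
  case 0
  then show ?case
    using sym_inv_rank_dom[OF 0(2)] by (intro bexI[of _ \<alpha>]) auto
next
  case (Suc k)
  note fin = sym_inv_rank_dom[OF Suc.prems]
  have fr: "finite (ran \<alpha>)"
    using Suc.prems by (simp add: sym_inv_rank_def)
  obtain x where x: "x \<in> L" "x \<notin> dom \<alpha> \<union> Z"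
    using assms(2,3) fin(1) by (metis finite_Un finite_subset subsetI)
  obtain y where y: "y \<in> L" "y \<notin> ran \<alpha>"
    using assms(2) fr by (metis finite_subset subsetI)
  have c: "card (dom \<alpha>) < n"
    using Suc.hyps(2) by simp
  let ?\<alpha> = "\<alpha>(x \<mapsto> y)"
  have r: "ran ?\<alpha> = insert y (ran \<alpha>)"
    using x(2) by (simp add: ran_map_upd domIff)
  have "inj_on ?\<alpha> (dom ?\<alpha>)"
    using Suc.prems x(2) y(2)
    by (auto simp: sym_inv_rank_def sym_inv_def inj_on_def ran_def)
  then have "?\<alpha> \<in> sym_inv_rank n L"
    using Suc.prems x y r c fr fin(3) by (auto simp: sym_inv_rank_def sym_inv_def)
  moreover have "k = n - card (dom ?\<alpha>)"
    using Suc.hyps(2) x(2) fin(1) by simp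
  ultimately obtain \<beta> where "\<beta> \<in> sym_inv_rank n L" "?\<alpha> \<subseteq>\<^sub>m \<beta>" "card (dom \<beta>) = n"
    "dom \<beta> \<inter> Z \<subseteq> dom ?\<alpha>"
    using Suc.hyps(1) by blast
  moreover have "\<alpha> \<subseteq>\<^sub>m ?\<alpha>"
    using x(2) by (auto simp: map_le_def)
  ultimately show ?case
    using x(2) by (intro bexI[of _ \<beta>]) (auto intro: map_le_trans)
qed

section \<open>Clopen sets of extensions and isolated points\<close>

locale feebly_compact_sym_inv_rank =
  fixes n :: nat and L :: "'a set" and \<tau> :: "('a \<rightharpoonup> 'a) topology"
  assumes infinite_L: "infinite L"
    and topspace: "topspace \<tau> = sym_inv_rank n L"
    and shift_continuous: "shift_continuous pmult \<tau>"
    and feebly_compact: "feebly_compact_space \<tau>"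
    and t1: "t1_space \<tau>"
begin

text \<open>The principal up-set of \<open>\<alpha>\<close> in the natural partial order of the
  inverse semigroup.\<close>

definition extensions :: "('a \<rightharpoonup> 'a) \<Rightarrow> ('a \<rightharpoonup> 'a) set"
  where "extensions \<alpha> = {\<beta> \<in> topspace \<tau>. \<alpha> \<subseteq>\<^sub>m \<beta>}"

lemma clopen_extensions:
  assumes "\<alpha> \<in> topspace \<tau>"
  shows "openin \<tau> (extensions \<alpha>)" "closedin \<tau> (extensions \<alpha>)"
proof -
  define \<epsilon> \<epsilon>' where "\<epsilon> = partial_id (dom \<alpha>)" and "\<epsilon>' = partial_id (ran \<alpha>)"
  define r where "r \<beta> = pmult (pmult \<epsilon> \<beta>) \<epsilon>'" for \<beta>
  have \<alpha>: "\<alpha> \<in> sym_inv_rank n L"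
    using assms topspace by simp
  note fin = sym_inv_rank_dom[OF \<alpha>]
  have fr: "finite (ran \<alpha>)"
    using \<alpha> by (simp add: sym_inv_rank_def)
  have "\<epsilon> \<in> topspace \<tau>" "\<epsilon>' \<in> topspace \<tau>"
    unfolding topspace \<epsilon>_def \<epsilon>'_def
    using \<alpha> fin fr by (intro partial_id_in_sym_inv_rank; simp add: sym_inv_rank_def sym_inv_def)+
  then have "continuous_map \<tau> \<tau> (\<lambda>\<beta>. pmult \<epsilon> \<beta>)" "continuous_map \<tau> \<tau> (\<lambda>\<beta>. pmult \<beta> \<epsilon>')"
    using shift_continuous by (auto simp: shift_continuous_def)
  then have r: "continuous_map \<tau> \<tau> r"
    using continuous_map_compose[of \<tau> \<tau> "pmult \<epsilon>" \<tau> "\<lambda>\<beta>. pmult \<beta> \<epsilon>'"]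
    by (simp add: r_def[abs_def] o_def)
  \<comment> \<open>The up-set is the fibre of the continuous map \<open>r\<close> over
    \<open>\<alpha>\<close>, hence closed in a T1 space.\<close>
  have ext: "extensions \<alpha> = {\<beta> \<in> topspace \<tau>. r \<beta> \<in> {\<alpha>}}"
    using pmult_partial_id_eq_iff[of _ \<alpha>]
    by (auto simp: extensions_def r_def \<epsilon>_def \<epsilon>'_def topspace sym_inv_rank_def sym_inv_def)
  show "closedin \<tau> (extensions \<alpha>)"
    unfolding ext using t1 assms
    by (intro closedin_continuous_map_preimage[OF r]) (simp add: t1_space_closedin_singleton)
  \<comment> \<open>Only finitely many values of \<open>r\<close> are possible, so the values other
    than \<open>\<alpha>\<close> form a closed set. Its preimage is the complement of the fibre,
    which is therefore open too.\<close>
  have "dom (r \<beta>) \<subseteq> dom \<alpha> \<and> ran (r \<beta>) \<subseteq> ran \<alpha>" for \<beta>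
    by (auto simp: r_def \<epsilon>_def \<epsilon>'_def pmult_def partial_id_def map_comp_Some_iff ran_def
        split: if_splits)
  then have "finite (r ` topspace \<tau>)"
    by (intro finite_subset[OF _ finite_maps_dom_ran[OF fin(1) fr]]) auto
  moreover have "r ` topspace \<tau> \<subseteq> topspace \<tau>"
    using r by (simp add: continuous_map_def Pi_iff image_subset_iff)
  ultimately have "closedin \<tau> (r ` topspace \<tau> - {\<alpha>})"
    using t1 unfolding t1_space_closedin_finite by blast
  then have "closedin \<tau> {\<beta> \<in> topspace \<tau>. r \<beta> \<in> r ` topspace \<tau> - {\<alpha>}}"
    by (rule closedin_continuous_map_preimage[OF r])
  then have "openin \<tau> (topspace \<tau> - {\<beta> \<in> topspace \<tau>. r \<beta> \<in> r ` topspace \<tau> - {\<alpha>}})"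
    by (rule openin_diff[OF openin_topspace])
  moreover have "topspace \<tau> - {\<beta> \<in> topspace \<tau>. r \<beta> \<in> r ` topspace \<tau> - {\<alpha>}} = extensions \<alpha>"
    unfolding ext by auto
  ultimately show "openin \<tau> (extensions \<alpha>)"
    by simp
qed

text \<open>A proper extension would have rank above \<open>n\<close>, so the open up-set of
  \<open>\<beta>\<close> is a single point.\<close>

lemma openin_singleton_full_rank:
  assumes "\<beta> \<in> topspace \<tau>" "card (dom \<beta>) = n"
  shows "openin \<tau> {\<beta>}"
proof -
  have "\<gamma> = \<beta>" if "\<gamma> \<in> extensions \<beta>" for \<gamma>
  proof -
    have \<gamma>: "\<gamma> \<in> sym_inv_rank n L" "\<beta> \<subseteq>\<^sub>m \<gamma>"
      using that topspace by (auto simp: extensions_def)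
    have "dom \<beta> = dom \<gamma>"
      using sym_inv_rank_dom[OF \<gamma>(1)] assms(2) map_le_implies_dom_le[OF \<gamma>(2)]
      by (intro card_seteq) auto
    then show ?thesis
      using map_le_dom_eq[OF \<gamma>(2)] by simp
  qed
  then have "extensions \<beta> = {\<beta>}"
    using assms(1) by (auto simp: extensions_def)
  then show ?thesis
    using clopen_extensions(1)[OF assms(1)] by simp
qed

section \<open>Consequences of feeble compactness\<close>

lemma locally_finite_open_family_finite:
  assumes "\<And>V. V \<in> \<V> \<Longrightarrow> openin \<tau> V"
    and "\<And>x. x \<in> topspace \<tau> \<Longrightarrow> \<exists>W. openin \<tau> W \<and> x \<in> W \<and> finite {V \<in> \<V>. V \<inter> W \<noteq> {}}"
  shows "finite \<V>"
proof -
  \<comment> \<open>Adding the whole space makes the family a cover and, being one more member,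
    keeps it locally finite.\<close>
  let ?\<U> = "insert (topspace \<tau>) \<V>"
  have "\<Union>?\<U> = topspace \<tau>"
    using assms(1) openin_subset by blast
  moreover have "locally_finite_in \<tau> ?\<U>"
    unfolding locally_finite_in_def
  proof (intro conjI ballI)
    show "\<Union>?\<U> \<subseteq> topspace \<tau>"
      using assms(1) openin_subset by blast
    fix x
    assume "x \<in> topspace \<tau>"
    then obtain W where W: "openin \<tau> W" "x \<in> W" "finite {V \<in> \<V>. V \<inter> W \<noteq> {}}"
      using assms(2) by blast
    have "{V \<in> ?\<U>. V \<inter> W \<noteq> {}} \<subseteq> insert (topspace \<tau>) {V \<in> \<V>. V \<inter> W \<noteq> {}}"
      by auto
    then have "finite {V \<in> ?\<U>. V \<inter> W \<noteq> {}}"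
      by (rule finite_subset) (simp add: W(3))
    with W(1,2) show "\<exists>W. openin \<tau> W \<and> x \<in> W \<and> finite {V \<in> ?\<U>. V \<inter> W \<noteq> {}}"
      by blast
  qed
  moreover have "\<forall>V\<in>?\<U>. openin \<tau> V"
    using assms(1) by blast
  ultimately have "finite ?\<U>"
    by (intro feebly_compact[unfolded feebly_compact_space_def, THEN spec, THEN mp] conjI)
  then show ?thesis
    by simp
qed

lemma full_rank_outside_nbhd:
  assumes "openin \<tau> U" "\<alpha> \<in> U"
  obtains F where "finite F" "\<And>\<delta>. \<delta> \<in> F \<Longrightarrow> \<delta> \<in> topspace \<tau> \<and> \<alpha> \<subseteq>\<^sub>m \<delta> \<and> \<delta> \<noteq> \<alpha>"
    "\<And>\<beta>. \<beta> \<in> extensions \<alpha> - U \<Longrightarrow> card (dom \<beta>) = n \<Longrightarrow> \<exists>\<delta>\<in>F. \<delta> \<subseteq>\<^sub>m \<beta>"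
proof (rule ccontr)
  assume none: "\<not> thesis"
  define W where "W = {\<beta> \<in> extensions \<alpha> - U. card (dom \<beta>) = n}"
  \<comment> \<open>\<open>P f k \<beta>\<close> says that \<open>\<beta>\<close> is admissible as
    the \<open>k\<close>-th term: with no earlier term does it share a restriction properly
    extending \<open>\<alpha>\<close>.\<close>
  define P where "P f k \<beta> \<longleftrightarrow> \<beta> \<in> W \<and>
      (\<forall>j<k. \<forall>\<delta>. \<alpha> \<subseteq>\<^sub>m \<delta> \<and> \<delta> \<subseteq>\<^sub>m f j \<and> \<delta> \<subseteq>\<^sub>m \<beta> \<longrightarrow> \<delta> = \<alpha>)" for f and k :: nat and \<beta>
  have W_top: "\<beta> \<in> sym_inv_rank n L" "\<alpha> \<subseteq>\<^sub>m \<beta>" "\<beta> \<notin> U" if "\<beta> \<in> W" for \<beta>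
    using that topspace by (auto simp: W_def extensions_def)
  have "\<exists>f. \<forall>k. P f k (f k)"
  proof (rule dependent_wellorder_choice)
    fix r and f g :: "nat \<Rightarrow> 'a \<rightharpoonup> 'a" and k :: nat
    assume "\<And>j. j < k \<Longrightarrow> f j = g j"
    then show "P f k r = P g k r"
      by (simp add: P_def)
  next
    fix k and f :: "nat \<Rightarrow> 'a \<rightharpoonup> 'a"
    assume prev: "\<And>j. j < k \<Longrightarrow> P f j (f j)"
    \<comment> \<open>The maps that the next term must not extend. They are finitely many, so if
      every \<open>\<beta>\<close> in \<open>W\<close> extended one of them, they would form the
      required set \<open>F\<close>.\<close>
    let ?F = "\<Union>j<k. {\<delta>. \<delta> \<subseteq>\<^sub>m f j \<and> \<alpha> \<subseteq>\<^sub>m \<delta> \<and> \<delta> \<noteq> \<alpha>}"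
    have fW: "f j \<in> W" if "j < k" for j
      using prev[OF that] by (simp add: P_def)
    have "finite {\<delta>. \<delta> \<subseteq>\<^sub>m f j \<and> \<alpha> \<subseteq>\<^sub>m \<delta> \<and> \<delta> \<noteq> \<alpha>}" if "j < k" for j
      using finite_map_le[OF sym_inv_rank_dom(1)[OF W_top(1)[OF fW[OF that]]]]
      by (rule rev_finite_subset) blast
    then have fin: "finite ?F"
      by blast
    have ext: "\<delta> \<in> topspace \<tau> \<and> \<alpha> \<subseteq>\<^sub>m \<delta> \<and> \<delta> \<noteq> \<alpha>" if "\<delta> \<in> ?F" for \<delta>
      using that sym_inv_rank_map_le[OF W_top(1)[OF fW]] topspace by blast
    have "\<exists>\<beta>\<in>W. \<forall>\<delta>\<in>?F. \<not> \<delta> \<subseteq>\<^sub>m \<beta>"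
    proof (rule ccontr)
      assume neg: "\<not> ?thesis"
      have "\<exists>\<delta>\<in>?F. \<delta> \<subseteq>\<^sub>m \<beta>" if "\<beta> \<in> extensions \<alpha> - U" "card (dom \<beta>) = n" for \<beta>
      proof -
        have "\<beta> \<in> W"
          using that by (simp add: W_def)
        with neg show ?thesis
          by blast
      qed
      with fin ext have thesis
        by (rule that)
      with none show False ..
    qed
    then obtain \<beta> where "\<beta> \<in> W" "\<forall>\<delta>\<in>?F. \<not> \<delta> \<subseteq>\<^sub>m \<beta>"
      by blast
    then have "P f k \<beta>"
      unfolding P_def by blast
    then show "\<exists>\<beta>. P f k \<beta>"
      by (rule exI[of "P f k" \<beta>])
  qed
  then obtain f where f: "P f k (f k)" for k
    by blast
  have fW: "f k \<in> W" for k
    using f by (simp add: P_def)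
  \<comment> \<open>\<open>P\<close> compares a term with earlier ones only; of two distinct indices
    one is the smaller.\<close>
  have sep: "\<delta> = \<alpha>" if "\<alpha> \<subseteq>\<^sub>m \<delta>" "\<delta> \<subseteq>\<^sub>m f j" "\<delta> \<subseteq>\<^sub>m f k" "j \<noteq> k" for \<delta> j k
    using that f[of j] f[of k] unfolding P_def by (metis linorder_neqE_nat)
  have "inj f"
  proof (rule injI, rule ccontr)
    fix j k
    assume "f j = f k" "j \<noteq> k"
    \<comment> \<open>A repeated term is its own common restriction, so it equals
      \<open>\<alpha>\<close>, which lies in \<open>U\<close>, whereas all terms avoid
      \<open>U\<close>.\<close>
    then have "f j = \<alpha>"
      using sep[of "f j" j k] W_top(2)[OF fW] by simp
    with W_top(3)[OF fW] assms(2) show False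
      by metis
  qed
  have "finite (range (\<lambda>k. {f k}))"
  proof (rule locally_finite_open_family_finite)
    fix V
    assume "V \<in> range (\<lambda>k. {f k})"
    then show "openin \<tau> V"
      using fW openin_singleton_full_rank by (auto simp: W_def extensions_def)
  next
    fix \<gamma>
    assume \<gamma>: "\<gamma> \<in> topspace \<tau>"
    have \<alpha>: "\<alpha> \<in> topspace \<tau>"
      using assms openin_subset by blast
    \<comment> \<open>Neighbourhoods for local finiteness: \<open>U\<close> and the complement of
      \<open>extensions \<alpha>\<close> contain no term at all, and
      \<open>extensions \<gamma>\<close> for a proper extension \<open>\<gamma>\<close> contains at
      most one, by \<open>sep\<close>.\<close>
    consider "\<gamma> = \<alpha>" | "\<not> \<alpha> \<subseteq>\<^sub>m \<gamma>" | "\<alpha> \<subseteq>\<^sub>m \<gamma>" "\<gamma> \<noteq> \<alpha>"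
      by blast
    then have "\<exists>W. openin \<tau> W \<and> \<gamma> \<in> W \<and> finite {k. f k \<in> W}"
    proof cases
      case 1
      then show ?thesis
        using assms W_top(3) fW by (intro exI[of _ U]) simp
    next
      case 2
      have "openin \<tau> (topspace \<tau> - extensions \<alpha>)"
        using clopen_extensions(2)[OF \<alpha>] by blast
      then show ?thesis
        using 2 \<gamma> fW by (intro exI[of _ "topspace \<tau> - extensions \<alpha>"])
          (auto simp: W_def extensions_def)
    next
      case 3
      have "j = k" if "f j \<in> extensions \<gamma>" "f k \<in> extensions \<gamma>" for j k
        using sep[of \<gamma> j k] 3 that by (auto simp: extensions_def)
      then have "{k. f k \<in> extensions \<gamma>} \<subseteq> {j}" if "f j \<in> extensions \<gamma>" for j
        using that by blast
      then have "finite {k. f k \<in> extensions \<gamma>}"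
        by (cases "\<exists>j. f j \<in> extensions \<gamma>") (auto intro: finite_subset)
      then show ?thesis
        using \<gamma> clopen_extensions(1)[OF \<gamma>]
        by (intro exI[of _ "extensions \<gamma>"]) (auto simp: extensions_def)
    qed
    then obtain W where W: "openin \<tau> W" "\<gamma> \<in> W" "finite {k. f k \<in> W}"
      by blast
    have "{V \<in> range (\<lambda>k. {f k}). V \<inter> W \<noteq> {}} \<subseteq> (\<lambda>k. {f k}) ` {k. f k \<in> W}"
      by auto
    with W show "\<exists>W. openin \<tau> W \<and> \<gamma> \<in> W \<and> finite {V \<in> range (\<lambda>k. {f k}). V \<inter> W \<noteq> {}}"
      by (meson finite_imageI finite_subset)
  qed
  moreover have "inj (\<lambda>k. {f k})"
    using \<open>inj f\<close> by (simp add: inj_def)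
  ultimately show False
    using finite_imageD infinite_UNIV_nat by blast
qed

section \<open>Density of rank \<open>n\<close> and regular open neighbourhoods\<close>

lemma full_rank_dense:
  assumes "openin \<tau> U" "U \<noteq> {}"
  shows "\<exists>\<beta>\<in>U. card (dom \<beta>) = n"
proof -
  obtain \<alpha> where \<alpha>: "\<alpha> \<in> U"
    using assms(2) by blast
  then obtain F where F: "finite F" "\<And>\<delta>. \<delta> \<in> F \<Longrightarrow> \<delta> \<in> topspace \<tau> \<and> \<alpha> \<subseteq>\<^sub>m \<delta> \<and> \<delta> \<noteq> \<alpha>"
    "\<And>\<beta>. \<beta> \<in> extensions \<alpha> - U \<Longrightarrow> card (dom \<beta>) = n \<Longrightarrow> \<exists>\<delta>\<in>F. \<delta> \<subseteq>\<^sub>m \<beta>"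
    by (rule full_rank_outside_nbhd[OF assms(1)]) (rule that)
  have "\<alpha> \<in> sym_inv_rank n L"
    using assms(1) \<alpha> openin_subset topspace by blast
  moreover have "finite (\<Union>\<delta>\<in>F. dom \<delta>)"
    using F(1,2) sym_inv_rank_dom(1) topspace by blast
  ultimately obtain \<beta> where \<beta>: "\<beta> \<in> sym_inv_rank n L" "\<alpha> \<subseteq>\<^sub>m \<beta>" "card (dom \<beta>) = n"
    "dom \<beta> \<inter> (\<Union>\<delta>\<in>F. dom \<delta>) \<subseteq> dom \<alpha>"
    using sym_inv_rank_extend[OF _ infinite_L] by meson
  \<comment> \<open>\<open>\<beta>\<close> uses no point of \<open>dom \<delta>\<close> outside
    \<open>dom \<alpha>\<close>, so it cannot extend a proper extension of \<open>\<alpha>\<close>.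
    By the choice of \<open>F\<close> it then cannot lie outside \<open>U\<close>.\<close>
  have "\<not> \<delta> \<subseteq>\<^sub>m \<beta>" if "\<delta> \<in> F" for \<delta>
  proof
    assume "\<delta> \<subseteq>\<^sub>m \<beta>"
    then have "dom \<delta> \<subseteq> dom \<alpha>"
      using \<beta>(4) that map_le_implies_dom_le by blast
    then show False
      using F(2)[OF that] map_le_dom_eq by blast
  qed
  moreover have "\<beta> \<in> extensions \<alpha>"
    using \<beta>(1,2) topspace by (simp add: extensions_def)
  ultimately have "\<beta> \<in> U"
    using F(3) \<beta>(3) by blast
  with \<beta>(3) show ?thesis
    by blast
qed

text \<open>Removing the up-sets of the maps in \<open>F\<close> from
  \<open>extensions \<alpha>\<close> leaves an open set whose points of rank \<open>n\<close> all
  lie in \<open>U\<close>. Density puts this set into the closure of \<open>U\<close>, and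
  regularity of \<open>U\<close> puts it into \<open>U\<close> itself.\<close>

lemma extensions_outside_regular_open:
  assumes "openin \<tau> U" "regular_open_in \<tau> U" "\<alpha> \<in> U"
  obtains F where "finite F" "\<And>\<delta>. \<delta> \<in> F \<Longrightarrow> \<delta> \<in> topspace \<tau> \<and> \<alpha> \<subseteq>\<^sub>m \<delta> \<and> \<delta> \<noteq> \<alpha>"
    "extensions \<alpha> - U \<subseteq> (\<Union>\<delta>\<in>F. extensions \<delta>)"
proof -
  obtain F where F: "finite F" "\<And>\<delta>. \<delta> \<in> F \<Longrightarrow> \<delta> \<in> topspace \<tau> \<and> \<alpha> \<subseteq>\<^sub>m \<delta> \<and> \<delta> \<noteq> \<alpha>"
    "\<And>\<beta>. \<beta> \<in> extensions \<alpha> - U \<Longrightarrow> card (dom \<beta>) = n \<Longrightarrow> \<exists>\<delta>\<in>F. \<delta> \<subseteq>\<^sub>m \<beta>"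
    by (rule full_rank_outside_nbhd[OF assms(1,3)]) (rule that)
  define V where "V = extensions \<alpha> - (\<Union>\<delta>\<in>F. extensions \<delta>)"
  have "\<alpha> \<in> topspace \<tau>"
    using assms openin_subset by blast
  \<comment> \<open>Openness of \<open>V\<close> needs both halves of clopenness:
    \<open>extensions \<alpha>\<close> is open and the finitely many removed up-sets are
    closed.\<close>
  then have V: "openin \<tau> V"
    unfolding V_def using F(1,2) clopen_extensions
    by (intro openin_diff closedin_Union) auto
  have "V \<subseteq> \<tau> closure_of U"
  proof
    fix \<gamma>
    assume \<gamma>: "\<gamma> \<in> V"
    have "\<exists>\<beta>\<in>U. \<beta> \<in> T" if "\<gamma> \<in> T" "openin \<tau> T" for T
    proof -
      have "openin \<tau> (V \<inter> T)" "V \<inter> T \<noteq> {}"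
        using V \<gamma> that by auto
      then obtain \<beta> where \<beta>: "\<beta> \<in> V" "\<beta> \<in> T" "card (dom \<beta>) = n"
        using full_rank_dense by blast
      then have "\<beta> \<in> U"
        using F(3)[of \<beta>] by (auto simp: V_def extensions_def)
      with \<beta>(2) show ?thesis
        by blast
    qed
    then show "\<gamma> \<in> \<tau> closure_of U"
      using \<gamma> by (auto simp: in_closure_of V_def extensions_def)
  qed
  then have "V \<subseteq> U"
    using interior_of_maximal[OF _ V] assms(2) by (auto simp: regular_open_in_def)
  then have "extensions \<alpha> - U \<subseteq> (\<Union>\<delta>\<in>F. extensions \<delta>)"
    by (auto simp: V_def)
  with F(1,2) show ?thesis
    by (rule that)
qed

section \<open>Compactness by induction on the corank\<close>

lemma compactin_extensions:
  assumes "semiregular_space \<tau>" "\<alpha> \<in> topspace \<tau>"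
  shows "compactin \<tau> (extensions \<alpha>)"
  using assms(2)
proof (induction "n - card (dom \<alpha>)" arbitrary: \<alpha> rule: less_induct)
  case less
  show ?case
    unfolding compactin_def
  proof (intro conjI allI impI)
    show "extensions \<alpha> \<subseteq> topspace \<tau>"
      by (auto simp: extensions_def)
    fix \<U>
    assume \<U>: "Ball \<U> (openin \<tau>) \<and> extensions \<alpha> \<subseteq> \<Union>\<U>"
    moreover have "\<alpha> \<in> extensions \<alpha>"
      using less.prems by (simp add: extensions_def)
    ultimately obtain U where U: "U \<in> \<U>" "\<alpha> \<in> U" "openin \<tau> U"
      by blast
    obtain \<B> where reg: "\<forall>B\<in>\<B>. regular_open_in \<tau> B"
      and base: "openin \<tau> = arbitrary union_of (\<lambda>B. B \<in> \<B>)"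
      using assms(1) unfolding semiregular_space_def by (elim exE conjE) (rule that)
    \<comment> \<open>A member \<open>U\<close> of an arbitrary open cover need not be regular open,
      so it is shrunk to a basic set \<open>B\<close> around \<open>\<alpha>\<close>.\<close>
    obtain B where B: "B \<in> \<B>" "openin \<tau> B" "\<alpha> \<in> B" "B \<subseteq> U"
      using base[unfolded openin_topology_base_unique] U(2,3) by blast
    have "regular_open_in \<tau> B"
      using reg B(1) by blast
    then obtain F where F: "finite F" "\<And>\<delta>. \<delta> \<in> F \<Longrightarrow> \<delta> \<in> topspace \<tau> \<and> \<alpha> \<subseteq>\<^sub>m \<delta> \<and> \<delta> \<noteq> \<alpha>"
      "extensions \<alpha> - B \<subseteq> (\<Union>\<delta>\<in>F. extensions \<delta>)"
      by (rule extensions_outside_regular_open[OF B(2) _ B(3)]) (rule that)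
    have "compactin \<tau> (extensions \<delta>)" if "\<delta> \<in> F" for \<delta>
    proof (rule less.hyps)
      show "\<delta> \<in> topspace \<tau>"
        using F(2) that by blast
      then have \<delta>: "finite (dom \<delta>)" "card (dom \<delta>) \<le> n"
        using sym_inv_rank_dom topspace by blast+
      \<comment> \<open>Proper extensions have strictly larger domains; as these have at most
        \<open>n\<close> points, the truncated difference really drops.\<close>
      have "dom \<alpha> \<subset> dom \<delta>"
        using F(2)[OF that] map_le_dom_eq[of \<alpha> \<delta>] map_le_implies_dom_le[of \<alpha> \<delta>] by blast
      then have "card (dom \<alpha>) < card (dom \<delta>)"
        using \<delta>(1) by (rule psubset_card_mono[rotated])
      then show "n - card (dom \<delta>) < n - card (dom \<alpha>)"
        using \<delta>(2) by simp
    qed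
    then have "compactin \<tau> (\<Union>\<delta>\<in>F. extensions \<delta>)"
      using F(1) by (intro compactin_Union) auto
    moreover have "(\<Union>\<delta>\<in>F. extensions \<delta>) \<subseteq> \<Union>\<U>"
    proof -
      have "extensions \<delta> \<subseteq> extensions \<alpha>" if "\<delta> \<in> F" for \<delta>
        using map_le_trans[of \<alpha> \<delta>] F(2)[OF that] by (auto simp: extensions_def)
      with \<U> show ?thesis
        by blast
    qed
    ultimately obtain \<F> where \<F>: "finite \<F>" "\<F> \<subseteq> \<U>" "(\<Union>\<delta>\<in>F. extensions \<delta>) \<subseteq> \<Union>\<F>"
      using \<U> unfolding compactin_def by meson
    \<comment> \<open>Points in \<open>B\<close> are covered by \<open>U\<close>; all others lie in
      the finitely many up-sets that \<open>\<F>\<close> covers.\<close>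
    have "extensions \<alpha> \<subseteq> \<Union>(insert U \<F>)"
      using F(3) B(4) \<F>(3) by blast
    with \<F> U(1) show "\<exists>\<F>. finite \<F> \<and> \<F> \<subseteq> \<U> \<and> extensions \<alpha> \<subseteq> \<Union>\<F>"
      by (intro exI[of _ "insert U \<F>"]) auto
  qed
qed

end

theorem theorem15:
  fixes n :: nat and L :: "'a set" and \<tau> :: "('a \<rightharpoonup> 'a) topology"
  assumes "n \<ge> 1"
    and "infinite L"
    and "topspace \<tau> = sym_inv_rank n L"
    and "shift_continuous pmult \<tau>"
    and "semiregular_space \<tau>"
    and "feebly_compact_space \<tau>"
    and "t1_space \<tau>"
  shows "compact_space \<tau>"
proof -
  interpret feebly_compact_sym_inv_rank n L \<tau>
    using assms by unfold_locales
  have "Map.empty \<in> topspace \<tau>"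
    by (simp add: topspace sym_inv_rank_def sym_inv_def)
  then have "compactin \<tau> (extensions Map.empty)"
    using compactin_extensions assms(5) by blast
  \<comment> \<open>Every map extends the empty map, so the whole space is one up-set.\<close>
  moreover have "extensions Map.empty = topspace \<tau>"
    by (simp add: extensions_def)
  ultimately show ?thesis
    by (simp add: compact_space_def)
qed

end
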